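(* Let $\beta\in(0,1)$ and let $E^{(\beta)}_t=\inf\{u>0:S^{(\beta)}_u>t\}$ be the inverse of a $\beta$-stable subordinator $(S^{(\beta)}_t)_{t\ge0}$ which is independent of a Brownian motion $(W_t)_{t\ge0}$ in $\mathbb{R}^d$. Let $\Omega$ be a bounded connected open set in $\mathbb{R}^d$ with a $C^\infty$ boundary, and let $(c_n)_{n\ge1}$ be the constants in the small-time asymptotic expansion of the Brownian spectral heat content, i.e. for every $N\in\mathbb{N}$, $$|\Omega|-Q^W_\Omega(t)=\sum_{n=1}^Nc_nt^{n/2}+O\big(t^{(N+1)/2}\big)\quad\text{as }t\downarrow0.$$ Then for every fixed $N\in\mathbb{N}$, $$|\Omega|-\tilde Q^{W\circ E^{(\beta)}}_\Omega(t)=\sum_{n=1}^Nc_n\frac{\Gamma(1+\frac n2)}{\Gamma(1+\frac{n\beta}2)}\,t^{\beta n/2}+O\big(t^{\beta(N+1)/2}\big)\quad\text{as }t\downarrow0.$$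
   Context: Brownian motion: $(W_t)$ is normalized so that $\mathbb{E}_0[e^{-i\langle\xi,W_t\rangle}]=e^{-t|\xi|^2}$ (generator $\Delta$). Under $\mathbb{P}_x$ (the product of the law of $W$ started at $x$ and the law of the independent time change) $W_0=x$. Heat contents: $\tau^W_\Omega=\inf\{t>0: W_t\in\Omega^c\}$ and $Q^W_\Omega(t)=\int_\Omega\mathbb{P}_x(\tau^W_\Omega>t)\,dx$. The killed process is $W^\Omega_t=W_t$ for $t<\tau^W_\Omega$ and $W^\Omega_t=\partial$ (a cemetery state, not in $\Omega$) for $t\ge\tau^W_\Omega$. The spectral heat content of the time-changed killed process is $\tilde Q^{W\circ E^{(\beta)}}_\Omega(t)=\int_\Omega\mathbb{P}_x(\tau^{W^\Omega\circ E^{(\beta)}}_\Omega>t)\,dx$, where $\tau^{W^\Omega\circ E^{(\beta)}}_\Omega=\inf\{t>0:W^\Omega_{E^{(\beta)}_t}\notin\Omega\}$. $|\Omega|$ is $d$-dimensional Lebesgue measure. The existence of the expansion of $|\Omega|-Q^W_\Omega(t)$ with constants $c_n$ is a known result (van den Berg and Gilkey, 1994) for compact Riemannian manifolds with $C^\infty$ boundary. A $\beta$-stable subordinator is the strictly increasing càdlàg Lévy process started at $0$ with $\mathbb{E}[e^{-sS^{(\beta)}_t}]=e^{-ts^\beta}$. *)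

theory Defs
  imports "HOL-Probability.Probability"
begin

section \<open>Brownian motion and stable subordinators\<close>

text \<open>
  Processes are indexed by \<open>real\<close>; only times \<open>t \<ge> 0\<close> matter. Path properties are required of every
  path, so that the exit events measured below really are events, without completing \<open>M\<close>.
\<close>

locale levy_process = prob_space M
  for M :: "'w measure" and X :: "real \<Rightarrow> 'w \<Rightarrow> 'a :: euclidean_space" +
  assumes measurable_process: "0 \<le> t \<Longrightarrow> random_variable borel (X t)"
    and starts_at_0: "\<omega> \<in> space M \<Longrightarrow> X 0 \<omega> = 0"
    and right_continuous_paths:
      "\<omega> \<in> space M \<Longrightarrow> 0 \<le> t \<Longrightarrow> ((\<lambda>s. X s \<omega>) \<longlongrightarrow> X t \<omega>) (at_right t)"
    and left_limits:
      "\<omega> \<in> space M \<Longrightarrow> 0 < t \<Longrightarrow> \<exists>l. ((\<lambda>s. X s \<omega>) \<longlongrightarrow> l) (at_left t)"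
    and independent_increments:
      "0 \<le> \<theta> 0 \<Longrightarrow> (\<And>i. i < n \<Longrightarrow> \<theta> i < \<theta> (Suc i)) \<Longrightarrow>
        indep_vars (\<lambda>_. borel) (\<lambda>i \<omega>. X (\<theta> (Suc i)) \<omega> - X (\<theta> i) \<omega>) {..<n}"
    and stationary_increments:
      "0 \<le> s \<Longrightarrow> s \<le> t \<Longrightarrow> distr M borel (\<lambda>\<omega>. X t \<omega> - X s \<omega>) = distr M borel (X (t - s))"

text \<open>The normalisation makes \<open>\<Delta>\<close>, and not \<open>\<Delta> / 2\<close>, the generator.\<close>

locale brownian_motion = levy_process M W
  for M :: "'w measure" and W :: "real \<Rightarrow> 'w \<Rightarrow> 'a :: euclidean_space" +
  assumes continuous_paths: "\<omega> \<in> space M \<Longrightarrow> continuous_on {0..} (\<lambda>t. W t \<omega>)"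
    and characteristic_function:
      "0 \<le> t \<Longrightarrow> expectation (\<lambda>\<omega>. iexp (- (\<xi> \<bullet> W t \<omega>))) = complex_of_real (exp (- t * (norm \<xi>)\<^sup>2))"

locale stable_subordinator = levy_process M S
  for M :: "'w measure" and \<beta> :: real and S :: "real \<Rightarrow> 'w \<Rightarrow> real" +
  assumes strictly_increasing_paths: "\<omega> \<in> space M \<Longrightarrow> strict_mono_on {0..} (\<lambda>t. S t \<omega>)"
    and laplace_transform:
      "0 \<le> t \<Longrightarrow> 0 \<le> s \<Longrightarrow> expectation (\<lambda>\<omega>. exp (- s * S t \<omega>)) = exp (- t * s powr \<beta>)"

text \<open>\<open>indep_var\<close> would force the two processes to take values in the same type.\<close>

definition independent_processes ::
  "'w measure \<Rightarrow> (real \<Rightarrow> 'w \<Rightarrow> 'a :: euclidean_space) \<Rightarrow> (real \<Rightarrow> 'w \<Rightarrow> 'b :: euclidean_space) \<Rightarrow> bool"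
  where "independent_processes M X Y \<longleftrightarrow>
    prob_space.indep_set M
      (sets (vimage_algebra (space M) (\<lambda>\<omega>. \<lambda>t\<in>{0..}. X t \<omega>) (\<Pi>\<^sub>M t\<in>{0..}. borel)))
      (sets (vimage_algebra (space M) (\<lambda>\<omega>. \<lambda>t\<in>{0..}. Y t \<omega>) (\<Pi>\<^sub>M t\<in>{0..}. borel)))"

section \<open>Exit times, killing and time change, path by path\<close>

text \<open>Infima of times are taken in \<open>ereal\<close>, where \<open>Inf {} = \<infinity>\<close>.\<close>

definition exit_time :: "'s set \<Rightarrow> (real \<Rightarrow> 's) \<Rightarrow> ereal"
  where "exit_time A p = Inf {ereal t | t. 0 < t \<and> p t \<notin> A}"

definition inverse_path :: "(real \<Rightarrow> real) \<Rightarrow> real \<Rightarrow> ereal"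
  where "inverse_path \<sigma> t = Inf {ereal u | u. 0 < u \<and> \<sigma> u > t}"

text \<open>
  The cemetery state is \<open>None\<close>. The time argument is extended because \<open>inverse_path\<close> may take the
  value \<open>\<infinity>\<close> (on a null set); the first branch is only reached for finite times.
\<close>

definition killed_path :: "'a set \<Rightarrow> (real \<Rightarrow> 'a) \<Rightarrow> ereal \<Rightarrow> 'a option"
  where "killed_path \<Omega> p u = (if u < exit_time \<Omega> p then Some (p (real_of_ereal u)) else None)"

section \<open>Spectral heat contents\<close>

text \<open>
  For a Brownian motion \<open>W\<close> started at \<open>0\<close> on \<open>M\<close>, the law of Brownian motion started at \<open>x\<close>, jointly
  with the independent subordinator \<open>S\<close>, is the law of \<open>(x + W, S)\<close> under \<open>M\<close>.
\<close>

definition heat_content ::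
  "'w measure \<Rightarrow> (real \<Rightarrow> 'w \<Rightarrow> 'a :: euclidean_space) \<Rightarrow> 'a set \<Rightarrow> real \<Rightarrow> real"
  where "heat_content M W \<Omega> t =
    (LINT x:\<Omega>|lborel. measure M {\<omega> \<in> space M. exit_time \<Omega> (\<lambda>s. x + W s \<omega>) > ereal t})"

definition time_changed_heat_content ::
  "'w measure \<Rightarrow> (real \<Rightarrow> 'w \<Rightarrow> 'a :: euclidean_space) \<Rightarrow> (real \<Rightarrow> 'w \<Rightarrow> real) \<Rightarrow> 'a set \<Rightarrow> real \<Rightarrow> real"
  where "time_changed_heat_content M W S \<Omega> t =
    (LINT x:\<Omega>|lborel. measure M {\<omega> \<in> space M.
      exit_time (Some ` \<Omega>)
        (\<lambda>s. killed_path \<Omega> (\<lambda>r. x + W r \<omega>) (inverse_path (\<lambda>u. S u \<omega>) s)) > ereal t})"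

section \<open>Smooth boundaries\<close>

primrec continuously_differentiable :: "nat \<Rightarrow> ('a :: euclidean_space \<Rightarrow> real) \<Rightarrow> bool"
  where
    "continuously_differentiable 0 f \<longleftrightarrow> continuous_on UNIV f"
  | "continuously_differentiable (Suc k) f \<longleftrightarrow>
      (\<forall>x. f differentiable (at x)) \<and>
      (\<forall>v. continuously_differentiable k (\<lambda>x. frechet_derivative f (at x) v))"

definition smooth_function :: "('a :: euclidean_space \<Rightarrow> real) \<Rightarrow> bool"
  where "smooth_function f \<longleftrightarrow> (\<forall>k. continuously_differentiable k f)"

text \<open>
  Near each boundary point, in suitable orthonormal coordinates, \<open>\<Omega>\<close> is the region strictly above
  the graph of a smooth function. Here \<open>e\<close> is the vertical direction and \<open>x - (x \<bullet> e) *\<^sub>R e\<close> the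
  horizontal part of \<open>x\<close>; only the values of \<open>\<gamma>\<close> on the hyperplane orthogonal to \<open>e\<close> are used.
\<close>

definition smooth_boundary :: "'a :: euclidean_space set \<Rightarrow> bool"
  where "smooth_boundary \<Omega> \<longleftrightarrow>
    (\<forall>p \<in> frontier \<Omega>. \<exists>r>0. \<exists>e \<gamma>. norm e = 1 \<and> smooth_function \<gamma> \<and>
      \<Omega> \<inter> ball p r = {x \<in> ball p r. \<gamma> (x - (x \<bullet> e) *\<^sub>R e) < x \<bullet> e})"

end

theory Submission
  imports Defs "HOL-Real_Asymp.Real_Asymp"
begin

text \<open>
  Write \<open>\<tau>\<close> for the exit time of Brownian motion from \<open>\<Omega>\<close>, \<open>Q\<close> for its heat content and \<open>E\<close> for the
  inverse subordinator. The killed process run along \<open>E\<close> is still alive at time \<open>t\<close> exactly when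
  \<open>E\<^sub>t < \<tau>\<close> (\<open>time_changed_exit_time_iff\<close>). Since \<open>E\<close> is independent of \<open>W\<close>, conditioning on \<open>E\<^sub>t\<close> and
  exchanging the integrals shows that the time-changed heat content is the expectation of \<open>Q(E\<^sub>t)\<close>
  (\<open>time_changed_heat_content_eq_expectation\<close>).

  The expansion of \<open>f = |\<Omega>| - Q\<close> is only given near \<open>0\<close>, whereas \<open>E\<^sub>t\<close> takes arbitrarily large values. But
  \<open>f\<close> is bounded and the remainder is compared with the largest power of \<open>u\<close> in sight, so the estimate
  \<open>\<bar>f(u) - \<Sum>n\<le>N. c\<^sub>n u\<^bsup>n/2\<^esup>\<bar> \<le> C u\<^bsup>(N+1)/2\<^esup>\<close> in fact holds for all \<open>u > 0\<close> with a suitable \<open>C\<close>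
  (\<open>uniform_bound_if_bounded_and_bigo_at_right_0\<close>). It can be evaluated at \<open>u = E\<^sub>t\<close> and integrated, and
  what remains is to know the moments of \<open>E\<^sub>t\<close>: the moment of order \<open>p\<close> is
  \<open>t\<^bsup>\<beta>p\<^esup> \<Gamma>(1 + p) / \<Gamma>(1 + \<beta>p)\<close>.

  The power of \<open>t\<close> in this formula comes from self-similarity: \<open>E\<^sub>t\<close> has the law of \<open>t\<^bsup>\<beta>\<^esup> E\<^sub>1\<close>
  (\<open>inverse_subordinator_scaling\<close>), because \<open>S\<close> at time \<open>t\<^bsup>\<beta>\<^esup> v\<close> has the law of \<open>t S\<^sub>v\<close>. The constant comes
  from Laplace transforms in \<open>t\<close>. For fixed \<open>u > 0\<close> the set of \<open>t\<close> with \<open>E\<^sub>t > u\<close> is, up to one point, the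
  half-line above \<open>S\<^sub>u\<close>; hence integrating \<open>P(E\<^sub>t > u)\<close> against \<open>e\<^bsup>-t\<^esup> dt\<close> gives the expectation of
  \<open>exp (- S\<^sub>u)\<close>, which is \<open>e\<^bsup>-u\<^esup>\<close>. Integrating this against \<open>p u\<^bsup>p-1\<^esup> du\<close> shows that the moment of order
  \<open>p\<close>, integrated against \<open>e\<^bsup>-t\<^esup> dt\<close>, equals \<open>\<Gamma>(1 + p)\<close>. By self-similarity it also equals
  \<open>\<Gamma>(1 + \<beta>p)\<close> times the moment of \<open>E\<^sub>1\<close>.
\<close>

section \<open>Laplace transforms determine laws on the half-line\<close>

text \<open>
  The absolute moments on the unit interval are at most \<open>1\<close>, so the Taylor polynomials of the
  characteristic function, which depend on the moments alone, converge to it.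
\<close>

lemma real_distribution_unit_interval_eqI:
  fixes \<mu> \<nu> :: "real measure"
  assumes "real_distribution \<mu>" and "real_distribution \<nu>"
    and "AE x in \<mu>. 0 \<le> x \<and> x \<le> 1" and "AE x in \<nu>. 0 \<le> x \<and> x \<le> 1"
    and moments: "\<And>k::nat. (LINT x|\<mu>. x ^ k) = (LINT x|\<nu>. x ^ k)"
  shows "\<mu> = \<nu>"
proof (rule Levy_uniqueness[OF assms(1,2)])
  define taylor where
    "taylor t n = (\<Sum>k\<le>n. (\<i> * complex_of_real t) ^ k / fact k * (LINT x|\<mu>. x ^ k))" for t n
  have approx: "cmod (char \<rho> t - taylor t n) \<le> 2 * \<bar>t\<bar> ^ n / fact n"
    if "real_distribution \<rho>" and unit: "AE x in \<rho>. 0 \<le> x \<and> x \<le> 1"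
      and "\<And>k::nat. (LINT x|\<rho>. x ^ k) = (LINT x|\<mu>. x ^ k)" for \<rho> t n
  proof -
    interpret real_distribution \<rho> by fact
    have integrable_power: "integrable \<rho> (\<lambda>x. x ^ k)" for k
    proof (rule integrable_const_bound[where B = 1])
      show "AE x in \<rho>. norm (x ^ k) \<le> 1"
        using unit by eventually_elim (auto intro: power_le_one)
    qed simp
    have "(LINT x|\<rho>. \<bar>x\<bar> ^ n) \<le> (LINT x|\<rho>. 1)"
    proof (rule integral_mono_AE)
      show "integrable \<rho> (\<lambda>x. \<bar>x\<bar> ^ n)"
        using integrable_abs[OF integrable_power[of n]] by (simp add: power_abs)
      show "AE x in \<rho>. \<bar>x\<bar> ^ n \<le> 1"
        using unit by eventually_elim (auto intro: power_le_one)
    qed simp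
    then have "(LINT x|\<rho>. \<bar>x\<bar> ^ n) \<le> 1"
      using prob_space by simp
    then have "2 * \<bar>t\<bar> ^ n / fact n * (LINT x|\<rho>. \<bar>x\<bar> ^ n) \<le> 2 * \<bar>t\<bar> ^ n / fact n * 1"
      by (intro mult_left_mono) auto
    with char_approx1[of n t, OF integrable_power] that(3) show ?thesis
      unfolding taylor_def by simp
  qed
  show "char \<mu> = char \<nu>"
  proof
    fix t
    have "cmod (char \<mu> t - char \<nu> t) \<le> 4 * (\<bar>t\<bar> ^ n / fact n)" for n
      using approx[OF assms(1,3), of t n] approx[OF assms(2,4), of t n] moments
        norm_triangle_ineq4[of "char \<mu> t - taylor t n" "char \<nu> t - taylor t n"] by simp
    moreover have "(\<lambda>n. 4 * (\<bar>t\<bar> ^ n / fact n)) \<longlonglongrightarrow> 0"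
      using tendsto_mult_left[OF summable_LIMSEQ_zero[OF summable_exp_generic[of "\<bar>t\<bar>"]], of 4]
      by (simp add: divide_inverse mult.commute)
    ultimately have "cmod (char \<mu> t - char \<nu> t) \<le> 0"
      by (intro LIMSEQ_le_const) auto
    then show "char \<mu> t = char \<nu> t" by simp
  qed
qed

text \<open>
  The values of the Laplace transform at the natural numbers are the moments of \<open>exp (- X)\<close>, a
  variable with values in the unit interval from which \<open>X\<close> can be recovered.
\<close>

lemma (in prob_space) distr_eq_if_laplace_transform_eq:
  fixes X Y :: "'a \<Rightarrow> real"
  assumes X [measurable]: "random_variable borel X" and Y [measurable]: "random_variable borel Y"
    and nonneg: "\<And>\<omega>. \<omega> \<in> space M \<Longrightarrow> 0 \<le> X \<omega>" "\<And>\<omega>. \<omega> \<in> space M \<Longrightarrow> 0 \<le> Y \<omega>"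
    and laplace: "\<And>k::nat. expectation (\<lambda>\<omega>. exp (- real k * X \<omega>)) = expectation (\<lambda>\<omega>. exp (- real k * Y \<omega>))"
  shows "distr M borel X = distr M borel Y"
proof -
  have recover: "distr M borel Z = distr (distr M borel (\<lambda>\<omega>. exp (- Z \<omega>))) borel (\<lambda>y. - ln y)"
    if [measurable]: "random_variable borel Z" for Z :: "'a \<Rightarrow> real"
    by (subst distr_distr) (measurable, simp add: comp_def)
  have "distr M borel (\<lambda>\<omega>. exp (- X \<omega>)) = distr M borel (\<lambda>\<omega>. exp (- Y \<omega>))"
  proof (rule real_distribution_unit_interval_eqI)
    fix k :: nat
    show "(LINT x|distr M borel (\<lambda>\<omega>. exp (- X \<omega>)). x ^ k)
        = (LINT x|distr M borel (\<lambda>\<omega>. exp (- Y \<omega>)). x ^ k)"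
      using laplace[of k] by (simp add: integral_distr exp_of_nat_mult[symmetric])
  qed (use nonneg in \<open>auto simp: AE_distr_iff real_distribution_distr intro!: AE_I2\<close>)
  with recover[OF X] recover[OF Y] show ?thesis by simp
qed

section \<open>The inverse of an increasing path\<close>

lemma inverse_path_less_iff:
  "inverse_path \<sigma> t < a \<longleftrightarrow> (\<exists>u>0. ereal u < a \<and> t < \<sigma> u)"
  unfolding inverse_path_def Inf_less_iff by auto

lemma inverse_path_le: "0 < u \<Longrightarrow> t < \<sigma> u \<Longrightarrow> inverse_path \<sigma> t \<le> ereal u"
  unfolding inverse_path_def by (rule Inf_lower) auto

lemma inverse_path_nonneg: "0 \<le> inverse_path \<sigma> t"
  unfolding inverse_path_def by (rule Inf_greatest) auto

text \<open>
  Together with \<open>inverse_path_le\<close> this shows that \<open>u < inverse_path \<sigma> t\<close> and \<open>\<sigma> u < t\<close> can differ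
  only for the single time \<open>t = \<sigma> u\<close>. Right-continuity yields a point beyond \<open>u\<close> at which \<open>\<sigma>\<close> is still
  below \<open>t\<close>, hence the strict inequality.
\<close>

lemma inverse_path_greater:
  assumes mono: "strict_mono_on {0..} \<sigma>" and "0 \<le> u" and "\<sigma> u < t"
    and lim: "(\<sigma> \<longlongrightarrow> \<sigma> u) (at_right u)"
  shows "ereal u < inverse_path \<sigma> t"
proof -
  have "eventually (\<lambda>s. \<sigma> s < t) (at_right u)"
    using order_tendstoD(2)[OF lim \<open>\<sigma> u < t\<close>] .
  then obtain v where v: "v > u" "\<And>s. u < s \<Longrightarrow> s < v \<Longrightarrow> \<sigma> s < t"
    unfolding eventually_at_right_field by blast
  have "ereal ((u + v) / 2) \<le> inverse_path \<sigma> t"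
    unfolding inverse_path_def
  proof (rule Inf_greatest)
    fix a assume "a \<in> {ereal s |s. 0 < s \<and> t < \<sigma> s}"
    then obtain s where s: "a = ereal s" "0 < s" "t < \<sigma> s" by auto
    show "ereal ((u + v) / 2) \<le> a"
    proof (rule ccontr)
      assume "\<not> ?thesis"
      then have "s < (u + v) / 2" using s by simp
      then have "\<sigma> s < \<sigma> ((u + v) / 2)"
        using s v \<open>0 \<le> u\<close> by (intro strict_mono_onD[OF mono]) auto
      also have "\<dots> < t" using v by (intro v(2)) auto
      finally show False using s by simp
    qed
  qed
  moreover have "ereal u < ereal ((u + v) / 2)" using v(1) by simp
  ultimately show ?thesis by (rule less_le_trans[rotated])
qed

text \<open>
  Describes the law of the inverse by the one-dimensional marginals of \<open>\<sigma>\<close>, although \<open>\<sigma>\<close> may jump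
  at \<open>u\<close>. The scale \<open>\<epsilon>\<close> is free so that the sequence approaching \<open>u\<close> can be rescaled together with \<open>u\<close>.
\<close>

lemma inverse_path_le_iff_seq:
  assumes mono: "strict_mono_on {0..} \<sigma>" and "0 \<le> u" "0 < \<epsilon>"
  shows "inverse_path \<sigma> t \<le> ereal u \<longleftrightarrow> (\<forall>n. t < \<sigma> (u + \<epsilon> / real (Suc n)))"
proof
  assume L: "inverse_path \<sigma> t \<le> ereal u"
  show "\<forall>n. t < \<sigma> (u + \<epsilon> / real (Suc n))"
  proof
    fix n
    have "ereal u < ereal (u + \<epsilon> / real (Suc n))" using assms by simp
    with L have "inverse_path \<sigma> t < ereal (u + \<epsilon> / real (Suc n))" by (rule le_less_trans)
    then obtain v where "v > 0" "v < u + \<epsilon> / real (Suc n)" "t < \<sigma> v"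
      unfolding inverse_path_less_iff by auto
    moreover from this have "\<sigma> v < \<sigma> (u + \<epsilon> / real (Suc n))"
      using assms by (intro strict_mono_onD[OF mono]) auto
    ultimately show "t < \<sigma> (u + \<epsilon> / real (Suc n))" by simp
  qed
next
  assume R: "\<forall>n. t < \<sigma> (u + \<epsilon> / real (Suc n))"
  have le: "inverse_path \<sigma> t \<le> ereal (u + \<epsilon> / real (Suc n))" for n
    using R assms by (intro inverse_path_le) (auto intro: add_nonneg_pos)
  have "(\<lambda>n. u + \<epsilon> / real (Suc n)) \<longlonglongrightarrow> u"
    by real_asymp
  then have "(\<lambda>n. ereal (u + \<epsilon> / real (Suc n))) \<longlonglongrightarrow> ereal u"
    by (rule tendsto_ereal)
  then show "inverse_path \<sigma> t \<le> ereal u"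
    by (rule LIMSEQ_le_const) (use le in auto)
qed

text \<open>
  The countable union over rational times makes the inverse jointly measurable in the time and the
  path.
\<close>

lemma inverse_path_less_iff_rat:
  assumes mono: "strict_mono_on {0..} \<sigma>"
  shows "inverse_path \<sigma> t < a \<longleftrightarrow> (\<exists>q::rat. 0 < q \<and> ereal (of_rat q) < a \<and> t < \<sigma> (of_rat q))"
proof
  assume "inverse_path \<sigma> t < a"
  then obtain u where u: "u > 0" "ereal u < a" "t < \<sigma> u"
    unfolding inverse_path_less_iff by auto
  obtain v where v: "ereal u < ereal v" "ereal v < a"
    using ereal_dense2[OF u(2)] by blast
  then obtain q where q: "u < real_of_rat q" "real_of_rat q < v"
    using of_rat_dense[of u v] by auto
  have "0 < real_of_rat q" using u(1) q(1) by (rule less_trans)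
  then have "0 < q" by simp
  moreover have "ereal (of_rat q) < a"
    using q v(2) by (metis ereal_less(2) less_ereal.simps(1) less_trans)
  moreover have "\<sigma> u < \<sigma> (of_rat q)" using q u \<open>0 < q\<close> by (intro strict_mono_onD[OF mono]) auto
  ultimately show "\<exists>q::rat. 0 < q \<and> ereal (of_rat q) < a \<and> t < \<sigma> (of_rat q)"
    using u by (intro exI[of _ q]) auto
next
  assume "\<exists>q::rat. 0 < q \<and> ereal (of_rat q) < a \<and> t < \<sigma> (of_rat q)"
  then obtain q :: rat where "0 < q" "ereal (of_rat q) < a" "t < \<sigma> (of_rat q)" by blast
  then show "inverse_path \<sigma> t < a"
    unfolding inverse_path_less_iff by (intro exI[of _ "of_rat q"]) simp
qed

section \<open>Moments of the inverse stable subordinator\<close>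

lemma nn_integral_exp_tail:
  "(\<integral>\<^sup>+t. ennreal (exp (- t)) * indicator {a..} t \<partial>lborel) = ennreal (exp (- a))"
proof -
  have "(\<integral>\<^sup>+t. ennreal (exp (- t)) * indicator {a..} t \<partial>lborel) = ennreal (0 - (- exp (- a)))"
  proof (rule nn_integral_FTC_atLeast)
    show "((\<lambda>t. - exp (- t)) \<longlongrightarrow> (0::real)) at_top" by real_asymp
  qed (auto intro!: derivative_eq_intros)
  then show ?thesis by simp
qed

text \<open>
  The layer-cake formula for a single value \<open>e\<close>. The infinite value is included because an inverse
  path is only almost surely finite, and this is itself deduced from the moments.
\<close>

lemma nn_integral_powr_below:
  assumes "0 < p" and "0 \<le> e"
  shows "(\<integral>\<^sup>+u. ennreal (p * u powr (p - 1)) * indicator {u. 0 < u \<and> ereal u < e} u \<partial>lborel)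
    = (if e = \<infinity> then \<infinity> else ennreal (real_of_ereal e powr p))" (is "?I e = _")
proof -
  have fin: "?I (ereal c) = ennreal (c powr p)" if "0 \<le> c" for c
  proof -
    have "((\<lambda>u. p * u powr (p - 1)) has_integral (p * (c powr (p - 1 + 1) / (p - 1 + 1)))) {0..c}"
      using assms that by (intro has_integral_mult_right has_integral_powr_from_0) auto
    then have "(\<integral>\<^sup>+u. ennreal (indicator {0..c} u * (p * u powr (p - 1))) \<partial>lborel) = ennreal (c powr p)"
      using assms by (subst nn_integral_has_integral_lebesgue[where I = "c powr p"]) auto
    also have "(\<integral>\<^sup>+u. ennreal (indicator {0..c} u * (p * u powr (p - 1))) \<partial>lborel) = ?I (ereal c)"
    proof (rule nn_integral_cong_AE)
      show "AE u in lborel. ennreal (indicator {0..c} u * (p * u powr (p - 1)))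
          = ennreal (p * u powr (p - 1)) * indicator {u. 0 < u \<and> ereal u < ereal c} u"
        using AE_lborel_singleton[of c] AE_lborel_singleton[of 0]
        by eventually_elim (auto simp: indicator_def)
    qed
    finally show ?thesis .
  qed
  show ?thesis
  proof (cases e)
    case PInf
    have "?I \<infinity> \<ge> ennreal (real n)" for n
    proof -
      have "ennreal (real n) = ennreal ((real n powr (1 / p)) powr p)"
        using assms by (simp add: powr_powr)
      also have "\<dots> = ?I (ereal (real n powr (1 / p)))"
        using fin[of "real n powr (1 / p)"] by simp
      also have "\<dots> \<le> ?I \<infinity>"
        by (intro nn_integral_mono mult_left_mono) (auto simp: indicator_def)
      finally show ?thesis .
    qed
    then have "?I \<infinity> = \<top>"
      by (metis ennreal_Ex_less_of_nat ennreal_of_nat_eq_real_of_nat not_less top.not_eq_extremum)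
    then show ?thesis using PInf by simp
  qed (use fin assms in auto)
qed

text \<open>
  The measurable space \<open>F\<close> is arbitrary: the lemma serves the underlying probability space as well as the
  \<open>\<sigma>\<close>-algebra generated by the subordinator alone, where independence is available.
\<close>

lemma borel_measurable_inverse_path:
  fixes S :: "real \<Rightarrow> 'w \<Rightarrow> real"
  assumes [measurable]: "\<And>u. 0 \<le> u \<Longrightarrow> S u \<in> borel_measurable F"
    and mono: "\<And>\<omega>. \<omega> \<in> space F \<Longrightarrow> strict_mono_on {0..} (\<lambda>u. S u \<omega>)"
  shows "(\<lambda>z. inverse_path (\<lambda>u. S u (snd z)) (fst z)) \<in> borel_measurable (borel \<Otimes>\<^sub>M F)"
proof (rule borel_measurableI_less)
  fix a :: ereal
  have "{z \<in> space (borel \<Otimes>\<^sub>M F). inverse_path (\<lambda>u. S u (snd z)) (fst z) < a}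
      = (\<Union>q\<in>{q::rat. 0 < q \<and> ereal (of_rat q) < a}.
          {z \<in> space (borel \<Otimes>\<^sub>M F). fst z < S (of_rat q) (snd z)})"
    using inverse_path_less_iff_rat[OF mono] by (fastforce simp: space_pair_measure)
  also have "\<dots> \<in> sets (borel \<Otimes>\<^sub>M F)"
    by (intro sets.countable_UN'') auto
  finally show "{z \<in> space (borel \<Otimes>\<^sub>M F). inverse_path (\<lambda>u. S u (snd z)) (fst z) < a}
      \<in> sets (borel \<Otimes>\<^sub>M F)" .
qed

context stable_subordinator
begin

abbreviation E :: "real \<Rightarrow> 'w \<Rightarrow> ereal"
  where "E t \<omega> \<equiv> inverse_path (\<lambda>u. S u \<omega>) t"

lemma subordinator_nonneg: "\<omega> \<in> space M \<Longrightarrow> 0 \<le> u \<Longrightarrow> 0 \<le> S u \<omega>"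
  using strict_mono_onD[OF strictly_increasing_paths, of \<omega> 0 u] starts_at_0[of \<omega>]
  by (cases "u = 0") auto

lemma inverse_subordinator_measurable2 [measurable]:
  "(\<lambda>z. E (fst z) (snd z)) \<in> borel_measurable (borel \<Otimes>\<^sub>M M)"
  by (rule borel_measurable_inverse_path) (use measurable_process strictly_increasing_paths in auto)

lemma inverse_subordinator_measurable3 [measurable]:
  "g \<in> borel_measurable N \<Longrightarrow> h \<in> measurable N M \<Longrightarrow> (\<lambda>z. E (g z) (h z)) \<in> borel_measurable N"
  using measurable_compose[OF measurable_Pair inverse_subordinator_measurable2, of g N h] by simp

text \<open>
  Both \<open>S (t powr \<beta> * v) / t\<close> and \<open>S v\<close> have the Laplace transform \<open>s \<mapsto> exp (- v * s powr \<beta>)\<close>.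
\<close>

lemma subordinator_scaling:
  assumes "0 < t" and "0 \<le> v"
  shows "prob {\<omega> \<in> space M. t < S (t powr \<beta> * v) \<omega>} = prob {\<omega> \<in> space M. 1 < S v \<omega>}"
proof -
  let ?X = "\<lambda>\<omega>. S (t powr \<beta> * v) \<omega> / t" and ?Y = "S v"
  have [measurable]: "S (t powr \<beta> * v) \<in> borel_measurable M" "S v \<in> borel_measurable M"
    using assms by (auto intro!: measurable_process)
  have "distr M borel ?X = distr M borel ?Y"
  proof (rule distr_eq_if_laplace_transform_eq)
    fix k :: nat
    have "expectation (\<lambda>\<omega>. exp (- real k * ?X \<omega>))
        = expectation (\<lambda>\<omega>. exp (- (real k / t) * S (t powr \<beta> * v) \<omega>))"
      by simp
    also have "\<dots> = exp (- (t powr \<beta> * v) * (real k / t) powr \<beta>)"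
      using assms by (intro laplace_transform) auto
    also have "\<dots> = exp (- v * real k powr \<beta>)"
      using assms by (simp add: powr_divide)
    also have "\<dots> = expectation (\<lambda>\<omega>. exp (- real k * S v \<omega>))"
      using assms by (intro laplace_transform[symmetric]) auto
    finally show "expectation (\<lambda>\<omega>. exp (- real k * ?X \<omega>)) = expectation (\<lambda>\<omega>. exp (- real k * ?Y \<omega>))" .
  qed (use assms subordinator_nonneg in auto)
  then have "measure (distr M borel ?X) {1<..} = measure (distr M borel ?Y) {1<..}"
    by simp
  also have "measure (distr M borel ?X) {1<..} = prob {\<omega> \<in> space M. t < S (t powr \<beta> * v) \<omega>}"
    using assms by (subst measure_distr) (auto intro!: arg_cong[where f = prob])
  also have "measure (distr M borel ?Y) {1<..} = prob {\<omega> \<in> space M. 1 < S v \<omega>}"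
    by (subst measure_distr) (auto intro!: arg_cong[where f = prob])
  finally show ?thesis .
qed

lemma prob_inverse_subordinator_le:
  assumes "0 \<le> u" and "0 < \<epsilon>"
  shows "(\<lambda>n. prob {\<omega> \<in> space M. t < S (u + \<epsilon> / real (Suc n)) \<omega>})
    \<longlonglongrightarrow> prob {\<omega> \<in> space M. E t \<omega> \<le> ereal u}"
proof -
  let ?A = "\<lambda>n. {\<omega> \<in> space M. t < S (u + \<epsilon> / real (Suc n)) \<omega>}"
  have [measurable]: "S (u + \<epsilon> / real (Suc n)) \<in> borel_measurable M" for n
    using assms by (intro measurable_process) auto
  have "(\<lambda>n. prob (?A n)) \<longlonglongrightarrow> prob (\<Inter>n. ?A n)"
  proof (rule finite_Lim_measure_decseq)
    show "decseq ?A"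
    proof (rule decseq_SucI, safe)
      fix n \<omega> assume *: "\<omega> \<in> space M" "t < S (u + \<epsilon> / real (Suc (Suc n))) \<omega>"
      have "S (u + \<epsilon> / real (Suc (Suc n))) \<omega> < S (u + \<epsilon> / real (Suc n)) \<omega>"
        using assms by (intro strict_mono_onD[OF strictly_increasing_paths[OF *(1)]])
          (auto intro!: divide_strict_left_mono)
      with * show "t < S (u + \<epsilon> / real (Suc n)) \<omega>" by simp
    qed
    show "range ?A \<subseteq> sets M" by (intro image_subsetI) measurable
  qed
  also have "(\<Inter>n. ?A n) = {\<omega> \<in> space M. E t \<omega> \<le> ereal u}"
    using inverse_path_le_iff_seq[OF strictly_increasing_paths assms] by auto
  finally show ?thesis .
qed

lemma inverse_subordinator_scaling:
  assumes "0 < t" and "0 \<le> u"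
  shows "emeasure M {\<omega> \<in> space M. ereal (t powr \<beta> * u) < E t \<omega>}
    = emeasure M {\<omega> \<in> space M. ereal u < E 1 \<omega>}"
proof -
  have "(\<lambda>n. prob {\<omega> \<in> space M. t < S (t powr \<beta> * u + t powr \<beta> / real (Suc n)) \<omega>})
      \<longlonglongrightarrow> prob {\<omega> \<in> space M. E t \<omega> \<le> ereal (t powr \<beta> * u)}"
    using assms by (intro prob_inverse_subordinator_le) auto
  moreover have "prob {\<omega> \<in> space M. t < S (t powr \<beta> * u + t powr \<beta> / real (Suc n)) \<omega>}
      = prob {\<omega> \<in> space M. 1 < S (u + 1 / real (Suc n)) \<omega>}" for n
    using subordinator_scaling[of t "u + 1 / real (Suc n)"] assms by (simp add: distrib_left)
  ultimately have "(\<lambda>n. prob {\<omega> \<in> space M. 1 < S (u + 1 / real (Suc n)) \<omega>})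
      \<longlonglongrightarrow> prob {\<omega> \<in> space M. E t \<omega> \<le> ereal (t powr \<beta> * u)}" by simp
  moreover have "(\<lambda>n. prob {\<omega> \<in> space M. 1 < S (u + 1 / real (Suc n)) \<omega>})
      \<longlonglongrightarrow> prob {\<omega> \<in> space M. E 1 \<omega> \<le> ereal u}"
    using assms by (intro prob_inverse_subordinator_le) auto
  ultimately have "prob {\<omega> \<in> space M. E t \<omega> \<le> ereal (t powr \<beta> * u)} = prob {\<omega> \<in> space M. E 1 \<omega> \<le> ereal u}"
    by (rule LIMSEQ_unique)
  moreover have "prob {\<omega> \<in> space M. ereal v < E s \<omega>} = 1 - prob {\<omega> \<in> space M. E s \<omega> \<le> ereal v}" for s v
    by (subst prob_compl[symmetric]) (auto intro!: arg_cong[where f = prob])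
  ultimately show ?thesis by (simp add: emeasure_eq_measure)
qed

text \<open>
  For each path the integral over \<open>t\<close> extends over \<open>E t \<omega> > u\<close>, which is the half-line above \<open>S u \<omega>\<close> up to
  a null set; it equals \<open>exp (- S u \<omega>)\<close>, whose expectation is known.
\<close>

lemma nn_integral_exp_tail_inverse_subordinator:
  assumes "0 < u"
  shows "(\<integral>\<^sup>+t. ennreal (exp (- t)) * indicator {0..} t * emeasure M {\<omega> \<in> space M. ereal u < E t \<omega>} \<partial>lborel)
    = ennreal (exp (- u))"
proof -
  interpret pair_sigma_finite M lborel ..
  let ?f = "\<lambda>\<omega> t. ennreal (exp (- t)) * indicator {0..} t * indicator {\<omega> \<in> space M. ereal u < E t \<omega>} \<omega>"
  have [measurable]: "S u \<in> borel_measurable M" using assms by (intro measurable_process) auto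
  have meas: "case_prod ?f \<in> borel_measurable (M \<Otimes>\<^sub>M lborel)"
    by measurable
  have "(\<integral>\<^sup>+t. ennreal (exp (- t)) * indicator {0..} t * emeasure M {\<omega> \<in> space M. ereal u < E t \<omega>} \<partial>lborel)
      = (\<integral>\<^sup>+t. \<integral>\<^sup>+\<omega>. ?f \<omega> t \<partial>M \<partial>lborel)"
    by (intro nn_integral_cong) (simp add: nn_integral_cmult)
  also have "\<dots> = (\<integral>\<^sup>+\<omega>. \<integral>\<^sup>+t. ?f \<omega> t \<partial>lborel \<partial>M)"
    by (rule Fubini'[OF meas])
  also have "\<dots> = (\<integral>\<^sup>+\<omega>. ennreal (exp (- S u \<omega>)) \<partial>M)"
  proof (rule nn_integral_cong)
    fix \<omega> assume \<omega>: "\<omega> \<in> space M"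
    have "(\<integral>\<^sup>+t. ?f \<omega> t \<partial>lborel) = (\<integral>\<^sup>+t. ennreal (exp (- t)) * indicator {S u \<omega>..} t \<partial>lborel)"
    proof (rule nn_integral_cong_AE)
      show "AE t in lborel. ?f \<omega> t = ennreal (exp (- t)) * indicator {S u \<omega>..} t"
        using AE_lborel_singleton[of "S u \<omega>"]
      proof eventually_elim
        case (elim t)
        then consider "t < S u \<omega>" | "S u \<omega> < t" by linarith
        then show ?case
        proof cases
          case 1
          then have "E t \<omega> \<le> ereal u" using assms by (intro inverse_path_le)
          with 1 show ?thesis by (simp add: indicator_def not_less[symmetric])
        next
          case 2
          then have "ereal u < E t \<omega>"
            using assms \<omega> by (intro inverse_path_greater strictly_increasing_paths right_continuous_paths) auto
          with 2 \<omega> subordinator_nonneg[OF \<omega>, of u] assms show ?thesis by (simp add: indicator_def)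
        qed
      qed
    qed
    then show "(\<integral>\<^sup>+t. ?f \<omega> t \<partial>lborel) = ennreal (exp (- S u \<omega>))"
      by (simp add: nn_integral_exp_tail)
  qed
  also have "\<dots> = ennreal (expectation (\<lambda>\<omega>. exp (- S u \<omega>)))"
    using assms by (intro nn_integral_eq_integral integrable_const_bound[where B = 1])
      (auto simp: subordinator_nonneg intro!: AE_I2)
  also have "\<dots> = ennreal (exp (- u))"
    using laplace_transform[of u 1] assms by simp
  finally show ?thesis .
qed

text \<open>
  By the layer-cake formula the moment is the integral \<open>G t\<close> of \<open>p * u powr (p - 1)\<close> against the tail
  probabilities of \<open>E t\<close>. Its Laplace transform at \<open>1\<close> is computed in two ways: with the preceding lemma it
  is \<open>\<Gamma>(1 + p)\<close>, and with the scaling relation it is \<open>\<Gamma>(1 + \<beta>p)\<close> times \<open>G 1\<close>. All integrals are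
  taken in \<open>ennreal\<close>, so that finiteness of the moment is part of the conclusion.
\<close>

lemma nn_integral_inverse_subordinator_powr:
  assumes "0 < \<beta>" and "0 < p" and "0 < t"
  shows "(\<integral>\<^sup>+\<omega>. (if E t \<omega> = \<infinity> then \<infinity> else ennreal (real_of_ereal (E t \<omega>) powr p)) \<partial>M)
    = ennreal (Gamma (1 + p) / Gamma (1 + \<beta> * p) * t powr (\<beta> * p))"
proof -
  interpret pair_sigma_finite lborel M ..
  define k where "k u = ennreal (p * u powr (p - 1)) * indicator {0<..} u" for u
  define L where "L t u = emeasure M {\<omega> \<in> space M. ereal u < E t \<omega>}" for t u
  define G where "G t = (\<integral>\<^sup>+u. k u * L t u \<partial>lborel)" for t
  have [measurable]: "k \<in> borel_measurable borel" unfolding k_def by measurable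
  \<comment> \<open>As an integral of an indicator, the tail probability inherits joint measurability in \<open>t\<close> and \<open>u\<close>.\<close>
  have [measurable]: "case_prod L \<in> borel_measurable (borel \<Otimes>\<^sub>M borel)"
  proof -
    have "(\<lambda>z. \<integral>\<^sup>+\<omega>. indicator {\<omega> \<in> space M. ereal (snd z) < E (fst z) \<omega>} \<omega> \<partial>M)
        \<in> borel_measurable (borel \<Otimes>\<^sub>M borel :: (real \<times> real) measure)"
      by measurable
    then show ?thesis by (simp add: L_def case_prod_beta')
  qed
  have moment: "(\<integral>\<^sup>+\<omega>. (if E t \<omega> = \<infinity> then \<infinity> else ennreal (real_of_ereal (E t \<omega>) powr p)) \<partial>M) = G t" for t
  proof -
    have "(\<integral>\<^sup>+\<omega>. (if E t \<omega> = \<infinity> then \<infinity> else ennreal (real_of_ereal (E t \<omega>) powr p)) \<partial>M)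
        = (\<integral>\<^sup>+\<omega>. \<integral>\<^sup>+u. k u * indicator {\<omega> \<in> space M. ereal u < E t \<omega>} \<omega> \<partial>lborel \<partial>M)"
    proof (rule nn_integral_cong)
      fix \<omega> assume "\<omega> \<in> space M"
      then show "(if E t \<omega> = \<infinity> then \<infinity> else ennreal (real_of_ereal (E t \<omega>) powr p))
          = (\<integral>\<^sup>+u. k u * indicator {\<omega> \<in> space M. ereal u < E t \<omega>} \<omega> \<partial>lborel)"
        by (subst nn_integral_powr_below[OF \<open>0 < p\<close> inverse_path_nonneg, symmetric])
          (auto intro!: nn_integral_cong simp: k_def indicator_def)
    qed
    also have "\<dots> = (\<integral>\<^sup>+u. \<integral>\<^sup>+\<omega>. k u * indicator {\<omega> \<in> space M. ereal u < E t \<omega>} \<omega> \<partial>M \<partial>lborel)"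
      by (rule Fubini') measurable
    also have "\<dots> = G t"
      unfolding G_def L_def by (intro nn_integral_cong) (simp add: nn_integral_cmult)
    finally show ?thesis .
  qed
  have scaling: "G t = ennreal (t powr (\<beta> * p)) * G 1" if "0 < t" for t
  proof -
    have "G t = ennreal (t powr \<beta>) * (\<integral>\<^sup>+u. k (t powr \<beta> * u) * L t (t powr \<beta> * u) \<partial>lborel)"
      unfolding G_def using that
      by (subst nn_integral_real_affine[where c = "t powr \<beta>" and t = 0]) auto
    also have "(\<integral>\<^sup>+u. k (t powr \<beta> * u) * L t (t powr \<beta> * u) \<partial>lborel)
        = (\<integral>\<^sup>+u. ennreal (t powr (\<beta> * (p - 1))) * (k u * L 1 u) \<partial>lborel)"
    proof (rule nn_integral_cong)
      fix u :: real
      show "k (t powr \<beta> * u) * L t (t powr \<beta> * u) = ennreal (t powr (\<beta> * (p - 1))) * (k u * L 1 u)"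
      proof (cases "0 < u")
        case True
        have "k (t powr \<beta> * u) = ennreal (t powr (\<beta> * (p - 1))) * k u"
          using True that \<open>0 < p\<close>
          by (simp add: k_def powr_mult powr_powr ennreal_mult[symmetric] mult_ac)
        moreover have "L t (t powr \<beta> * u) = L 1 u"
          using True that inverse_subordinator_scaling[of t u] by (simp add: L_def)
        ultimately show ?thesis by (simp add: mult_ac)
      next
        case False
        then have "\<not> 0 < t powr \<beta> * u" using that by (simp add: zero_less_mult_iff)
        with False show ?thesis by (simp add: k_def)
      qed
    qed
    also have "\<dots> = ennreal (t powr (\<beta> * (p - 1))) * G 1"
      unfolding G_def by (rule nn_integral_cmult) measurable
    also have "ennreal (t powr \<beta>) * (ennreal (t powr (\<beta> * (p - 1))) * G 1)
        = ennreal (t powr \<beta> * t powr (\<beta> * (p - 1))) * G 1"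
      by (simp add: ennreal_mult mult_ac)
    also have "t powr \<beta> * t powr (\<beta> * (p - 1)) = t powr (\<beta> * p)"
      by (simp add: powr_add[symmetric] algebra_simps)
    finally show ?thesis .
  qed
  \<comment> \<open>First evaluation: integrate over \<open>t\<close> before \<open>u\<close>, leaving Euler's integral for \<open>\<Gamma>(p)\<close>.\<close>
  have "(\<integral>\<^sup>+t. ennreal (exp (- t)) * indicator {0..} t * G t \<partial>lborel) = ennreal (Gamma (1 + p))"
  proof -
    have "(\<integral>\<^sup>+t. ennreal (exp (- t)) * indicator {0..} t * G t \<partial>lborel)
        = (\<integral>\<^sup>+t. \<integral>\<^sup>+u. ennreal (exp (- t)) * indicator {0..} t * (k u * L t u) \<partial>lborel \<partial>lborel)"
      unfolding G_def by (intro nn_integral_cong nn_integral_cmult[symmetric]) measurable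
    also have "\<dots> = (\<integral>\<^sup>+u. \<integral>\<^sup>+t. ennreal (exp (- t)) * indicator {0..} t * (k u * L t u) \<partial>lborel \<partial>lborel)"
      by (rule lborel_pair.Fubini') measurable
    also have "\<dots> = (\<integral>\<^sup>+u. \<integral>\<^sup>+t. k u * (ennreal (exp (- t)) * indicator {0..} t * L t u) \<partial>lborel \<partial>lborel)"
      by (simp add: mult_ac)
    also have "\<dots> = (\<integral>\<^sup>+u. k u * (\<integral>\<^sup>+t. ennreal (exp (- t)) * indicator {0..} t * L t u \<partial>lborel) \<partial>lborel)"
      by (intro nn_integral_cong nn_integral_cmult) measurable
    also have "\<dots> = (\<integral>\<^sup>+u. ennreal p * ennreal (indicator {0..} u * u powr (p - 1) / exp u) \<partial>lborel)"
    proof (rule nn_integral_cong_AE)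
      show "AE u in lborel. k u * (\<integral>\<^sup>+t. ennreal (exp (- t)) * indicator {0..} t * L t u \<partial>lborel)
          = ennreal p * ennreal (indicator {0..} u * u powr (p - 1) / exp u)"
        using AE_lborel_singleton[of 0]
      proof eventually_elim
        case (elim u)
        show ?case
          using nn_integral_exp_tail_inverse_subordinator[of u] elim \<open>0 < p\<close>
          by (cases "0 < u") (auto simp: k_def L_def ennreal_mult[symmetric] exp_minus field_simps)
      qed
    qed
    also have "\<dots> = ennreal (p * Gamma p)"
      using \<open>0 < p\<close> by (subst nn_integral_cmult) (auto simp: Gamma_conv_nn_integral_real[symmetric] ennreal_mult Gamma_real_pos less_imp_le)
    also have "p * Gamma p = Gamma (1 + p)"
    proof -
      have "p \<notin> \<int>\<^sub>\<le>\<^sub>0" using \<open>0 < p\<close> by (auto elim!: nonpos_Ints_cases)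
      then show ?thesis using Gamma_plus1[of p] by (simp add: add.commute)
    qed
    finally show ?thesis .
  qed
  \<comment> \<open>Second evaluation: insert the scaling relation, leaving Euler's integral for \<open>\<Gamma>(1 + \<beta>p)\<close>.\<close>
  moreover have "(\<integral>\<^sup>+t. ennreal (exp (- t)) * indicator {0..} t * G t \<partial>lborel) = ennreal (Gamma (1 + \<beta> * p)) * G 1"
  proof -
    have "(\<integral>\<^sup>+t. ennreal (exp (- t)) * indicator {0..} t * G t \<partial>lborel)
        = (\<integral>\<^sup>+t. ennreal (indicator {0..} t * t powr (1 + \<beta> * p - 1) / exp t) * G 1 \<partial>lborel)"
    proof (rule nn_integral_cong_AE)
      show "AE t in lborel. ennreal (exp (- t)) * indicator {0..} t * G t
          = ennreal (indicator {0..} t * t powr (1 + \<beta> * p - 1) / exp t) * G 1"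
        using AE_lborel_singleton[of 0]
      proof eventually_elim
        case (elim t)
        show ?case
          using elim scaling[of t]
          by (cases "0 < t") (auto simp: ennreal_mult[symmetric] exp_minus field_simps mult.assoc[symmetric])
      qed
    qed
    also have "\<dots> = ennreal (Gamma (1 + \<beta> * p)) * G 1"
      using assms by (subst nn_integral_multc) (auto simp: Gamma_conv_nn_integral_real add_pos_pos)
    finally show ?thesis .
  qed
  ultimately have "ennreal (Gamma (1 + \<beta> * p)) * G 1 = ennreal (Gamma (1 + p))" by simp
  moreover have "0 < Gamma (1 + \<beta> * p)" "0 < Gamma (1 + p)"
    using assms by (auto intro!: Gamma_real_pos add_pos_pos)
  ultimately have "G 1 = ennreal (Gamma (1 + p) / Gamma (1 + \<beta> * p))"
    by (cases "G 1") (auto simp: ennreal_mult[symmetric] ennreal_mult_top field_simps)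
  then show ?thesis
    using moment scaling[OF \<open>0 < t\<close>] by (simp add: ennreal_mult'[symmetric] mult.commute)
qed

text \<open>
  Finiteness follows from the first moment; positivity holds for every path because the subordinator
  starts at \<open>0\<close> and is right-continuous there.
\<close>

lemma inverse_subordinator_finite:
  assumes "0 < \<beta>" and "0 < t"
  shows "AE \<omega> in M. E t \<omega> = ereal (real_of_ereal (E t \<omega>)) \<and> 0 < real_of_ereal (E t \<omega>)"
proof -
  have "AE \<omega> in M. (if E t \<omega> = \<infinity> then \<infinity> else ennreal (real_of_ereal (E t \<omega>) powr 1)) \<noteq> \<infinity>"
    using nn_integral_inverse_subordinator_powr[of 1 t] assms
    by (intro nn_integral_PInf_AE) auto
  moreover have "AE \<omega> in M. 0 < E t \<omega>"
  proof (rule AE_I2)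
    fix \<omega> assume "\<omega> \<in> space M"
    then have "ereal 0 < E t \<omega>"
      using assms starts_at_0 by (intro inverse_path_greater strictly_increasing_paths right_continuous_paths) auto
    then show "0 < E t \<omega>" by (simp add: zero_ereal_def)
  qed
  ultimately show ?thesis
  proof eventually_elim
    case (elim \<omega>)
    then show ?case by (cases "E t \<omega>") (auto split: if_splits)
  qed
qed

lemma has_bochner_integral_inverse_subordinator_powr:
  assumes "0 < \<beta>" and "0 < p" and "0 < t"
  shows "has_bochner_integral M (\<lambda>\<omega>. real_of_ereal (E t \<omega>) powr p)
    (Gamma (1 + p) / Gamma (1 + \<beta> * p) * t powr (\<beta> * p))"
proof (rule has_bochner_integral_nn_integral)
  show "(\<integral>\<^sup>+\<omega>. ennreal (real_of_ereal (E t \<omega>) powr p) \<partial>M)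
      = ennreal (Gamma (1 + p) / Gamma (1 + \<beta> * p) * t powr (\<beta> * p))"
    unfolding nn_integral_inverse_subordinator_powr[OF assms, symmetric]
  proof (rule nn_integral_cong_AE)
    show "AE \<omega> in M. ennreal (real_of_ereal (E t \<omega>) powr p)
        = (if E t \<omega> = \<infinity> then \<infinity> else ennreal (real_of_ereal (E t \<omega>) powr p))"
      using inverse_subordinator_finite[OF assms(1,3)]
    proof eventually_elim
      case (elim \<omega>)
      then show ?case by (cases "E t \<omega>") auto
    qed
  qed
  show "0 \<le> Gamma (1 + p) / Gamma (1 + \<beta> * p) * t powr (\<beta> * p)"
    using assms by (auto intro!: divide_nonneg_nonneg mult_nonneg_nonneg less_imp_le[OF Gamma_real_pos] add_pos_pos)
qed auto

end

section \<open>Exit times of continuous paths\<close>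

lemma exit_time_le: "0 < t \<Longrightarrow> p t \<notin> A \<Longrightarrow> exit_time A p \<le> ereal t"
  unfolding exit_time_def by (rule Inf_lower) auto

lemma exit_time_nonneg: "0 \<le> exit_time A p"
  unfolding exit_time_def by (rule Inf_greatest) auto

lemma le_exit_timeI: "(\<And>t. 0 < t \<Longrightarrow> p t \<notin> A \<Longrightarrow> ereal s \<le> ereal t) \<Longrightarrow> ereal s \<le> exit_time A p"
  unfolding exit_time_def by (rule Inf_greatest) auto

text \<open>
  A continuous path stays in \<open>\<Omega>\<close> during the compact interval from \<open>0\<close> to \<open>u\<close> if and only if it keeps a
  positive distance from the complement, and by continuity this can be tested at countably many times.
  Clamping the rational times to the interval ensures that its endpoint \<open>u\<close> is among them, even if \<open>u\<close> is
  irrational or \<open>0\<close>.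
\<close>

lemma less_exit_time_iff:
  fixes p :: "real \<Rightarrow> 'a :: euclidean_space"
  assumes "open \<Omega>" and "\<Omega> \<noteq> UNIV" and cont: "continuous_on {0..} p" and "p 0 \<in> \<Omega>" and "0 \<le> u"
  shows "ereal u < exit_time \<Omega> p \<longleftrightarrow>
    (\<exists>k::nat. \<forall>q::rat. 1 / real (Suc k) \<le> infdist (p (max 0 (min (of_rat q) u))) (- \<Omega>))"
proof -
  define d where "d s = infdist (p (max 0 (min s u))) (- \<Omega>)" for s
  have "continuous_on UNIV d"
    unfolding d_def
    by (intro continuous_on_infdist continuous_on_compose2[OF cont] continuous_intros) auto
  have clamp: "max 0 (min s u) \<in> {0..u}" for s using \<open>0 \<le> u\<close> by auto
  show ?thesis
  proof
    assume less: "ereal u < exit_time \<Omega> p"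
    have inside: "p s \<in> \<Omega>" if "s \<in> {0..u}" for s
    proof (rule ccontr)
      assume "p s \<notin> \<Omega>"
      then have "0 < s" using \<open>p 0 \<in> \<Omega>\<close> that by (cases "s = 0") auto
      then have "exit_time \<Omega> p \<le> ereal s" using \<open>p s \<notin> \<Omega>\<close> by (rule exit_time_le)
      also have "\<dots> \<le> ereal u" using that by simp
      finally show False using less by simp
    qed
    have "\<exists>s\<in>{0..u}. \<forall>r\<in>{0..u}. d s \<le> d r"
      using \<open>continuous_on UNIV d\<close> \<open>0 \<le> u\<close>
      by (intro continuous_attains_inf) (auto intro: continuous_on_subset)
    then obtain s where s: "s \<in> {0..u}" "\<And>r. r \<in> {0..u} \<Longrightarrow> d s \<le> d r"
      by blast
    have "p (max 0 (min s u)) \<notin> - \<Omega>" using inside clamp by auto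
    then have "0 < d s"
      unfolding d_def using assms by (intro infdist_pos_not_in_closed) auto
    then obtain k where k: "1 / real (Suc k) < d s"
      using reals_Archimedean by (auto simp: inverse_eq_divide)
    have "1 / real (Suc k) \<le> d r" for r
    proof -
      have "d s \<le> d (max 0 (min r u))" by (rule s(2)) (rule clamp)
      also have "\<dots> = d r" using \<open>0 \<le> u\<close> by (simp add: d_def min_def max_def)
      finally show ?thesis using k by simp
    qed
    then show "\<exists>k::nat. \<forall>q::rat. 1 / real (Suc k) \<le> infdist (p (max 0 (min (of_rat q) u))) (- \<Omega>)"
      unfolding d_def by blast
  next
    assume "\<exists>k::nat. \<forall>q::rat. 1 / real (Suc k) \<le> infdist (p (max 0 (min (of_rat q) u))) (- \<Omega>)"
    then obtain k :: nat where k: "\<And>q::rat. 1 / real (Suc k) \<le> d (of_rat q)"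
      unfolding d_def by blast
    have "closed {s. 1 / real (Suc k) \<le> d s}"
      using \<open>continuous_on UNIV d\<close> by (intro closed_Collect_le) auto
    moreover have "\<rat> \<subseteq> {s. 1 / real (Suc k) \<le> d s}"
      using k by (auto simp: Rats_def)
    ultimately have "closure \<rat> \<subseteq> {s. 1 / real (Suc k) \<le> d s}"
      by (intro closure_minimal)
    then have pos: "1 / real (Suc k) \<le> d s" for s
      by (auto simp: Rats_closure_real)
    have inside: "p s \<in> \<Omega>" if "s \<in> {0..u}" for s
    proof (rule ccontr)
      assume "p s \<notin> \<Omega>"
      then have "d s = 0" using that by (auto simp: d_def min_def max_def)
      with pos[of s] show False by simp
    qed
    \<comment> \<open>Strict inequality: since \<open>\<Omega>\<close> is open, the path also stays inside for a short time after \<open>u\<close>.\<close>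
    have "(p \<longlongrightarrow> p u) (at_right u)"
      using cont \<open>0 \<le> u\<close>
      by (auto simp: continuous_on_def intro: tendsto_within_subset)
    then have "eventually (\<lambda>s. p s \<in> \<Omega>) (at_right u)"
      using \<open>open \<Omega>\<close> inside \<open>0 \<le> u\<close> by (intro topological_tendstoD) auto
    then obtain v where v: "u < v" "\<And>s. u < s \<Longrightarrow> s < v \<Longrightarrow> p s \<in> \<Omega>"
      unfolding eventually_at_right_field by blast
    have "ereal v \<le> exit_time \<Omega> p"
    proof (rule le_exit_timeI)
      fix t assume "0 < t" "p t \<notin> \<Omega>"
      then show "ereal v \<le> ereal t"
        using inside[of t] v(2)[of t] by (cases "t \<le> u"; cases "t < v") auto
    qed
    moreover have "ereal u < ereal v" using v(1) by simp
    ultimately show "ereal u < exit_time \<Omega> p" by (rule less_le_trans[rotated])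
  qed
qed

text \<open>
  Applied twice: with \<open>F\<close> the \<open>\<sigma>\<close>-algebra generated by Brownian motion and a fixed starting point, for
  independence; and with \<open>F\<close> the product of \<open>\<Omega>\<close> and the probability space, for Fubini's theorem in the
  starting point.
\<close>

lemma borel_measurable_exit_time:
  fixes Y :: "real \<Rightarrow> 'z \<Rightarrow> 'a :: euclidean_space"
  assumes "open \<Omega>" and "\<Omega> \<noteq> UNIV"
    and meas: "\<And>s. 0 \<le> s \<Longrightarrow> Y s \<in> borel_measurable F"
    and cont: "\<And>z. z \<in> space F \<Longrightarrow> continuous_on {0..} (\<lambda>s. Y s z)"
    and start: "\<And>z. z \<in> space F \<Longrightarrow> Y 0 z \<in> \<Omega>"
  shows "(\<lambda>z. exit_time \<Omega> (\<lambda>s. Y s z)) \<in> borel_measurable F"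
proof (rule borel_measurableI_greater)
  fix y :: ereal
  consider "y = \<infinity>" | "y < 0" | u where "0 \<le> u" "y = ereal u"
    by (cases y) (auto simp: not_le[symmetric])
  then show "{z \<in> space F. y < exit_time \<Omega> (\<lambda>s. Y s z)} \<in> sets F"
  proof cases
    case 2
    then have "y < exit_time \<Omega> p" for p :: "real \<Rightarrow> 'a"
      using exit_time_nonneg by (rule less_le_trans)
    then show ?thesis by simp
  next
    case (3 u)
    have [measurable]: "Y (max 0 (min (of_rat q) u)) \<in> borel_measurable F" for q
      by (rule meas) simp
    have [measurable]: "(\<lambda>z. infdist (Y (max 0 (min (of_rat q) u)) z) (- \<Omega>)) \<in> borel_measurable F" for q
      by (rule borel_measurable_continuous_on[where f = "\<lambda>x. infdist x (- \<Omega>)"])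
        (auto intro!: continuous_on_infdist continuous_on_id)
    have "{z \<in> space F. y < exit_time \<Omega> (\<lambda>s. Y s z)}
        = {z \<in> space F. \<exists>k::nat. \<forall>q::rat. 1 / real (Suc k) \<le> infdist (Y (max 0 (min (of_rat q) u)) z) (- \<Omega>)}"
      using less_exit_time_iff[OF assms(1,2) cont start \<open>0 \<le> u\<close>] 3 by auto
    also have "\<dots> \<in> sets F" by measurable
    finally show ?thesis .
  qed simp
qed

section \<open>Exit of the time-changed killed process\<close>

lemma killed_path_alive_iff:
  assumes "p 0 \<in> \<Omega>" and "0 \<le> u"
  shows "killed_path \<Omega> p u \<in> Some ` \<Omega> \<longleftrightarrow> u < exit_time \<Omega> p"
proof
  assume less: "u < exit_time \<Omega> p"
  then obtain r where r: "u = ereal r" "0 \<le> r"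
    using assms(2) by (cases u) auto
  have "p r \<in> \<Omega>"
  proof (rule ccontr)
    assume "p r \<notin> \<Omega>"
    then have "0 < r" using assms(1) r by (cases "r = 0") auto
    then have "exit_time \<Omega> p \<le> u" using exit_time_le[of r p \<Omega>] \<open>p r \<notin> \<Omega>\<close> r by simp
    with less show False by simp
  qed
  with less r show "killed_path \<Omega> p u \<in> Some ` \<Omega>" by (simp add: killed_path_def)
qed (auto simp: killed_path_def split: if_splits)

text \<open>
  The killed process cannot return, so only \<open>inverse_path \<sigma> t < exit_time \<Omega> p\<close> at the time \<open>t\<close> itself
  matters. For the direction from right to left a margin beyond \<open>t\<close> is needed: there is \<open>u\<close> before the exit
  time with \<open>\<sigma> u > t\<close>, and the inverse path does not exceed \<open>u\<close> before the time \<open>\<sigma> u\<close>.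
\<close>

lemma time_changed_exit_time_iff:
  assumes "p 0 \<in> \<Omega>" and "0 < t"
  shows "ereal t < exit_time (Some ` \<Omega>) (\<lambda>s. killed_path \<Omega> p (inverse_path \<sigma> s))
    \<longleftrightarrow> inverse_path \<sigma> t < exit_time \<Omega> p"
    (is "ereal t < exit_time _ ?X \<longleftrightarrow> _")
proof
  assume less: "ereal t < exit_time (Some ` \<Omega>) ?X"
  have "?X t \<in> Some ` \<Omega>"
  proof (rule ccontr)
    assume "?X t \<notin> Some ` \<Omega>"
    then have "exit_time (Some ` \<Omega>) ?X \<le> ereal t" using \<open>0 < t\<close> by (intro exit_time_le)
    with less show False by simp
  qed
  then show "inverse_path \<sigma> t < exit_time \<Omega> p"
    using killed_path_alive_iff[of p, OF assms(1) inverse_path_nonneg] by blast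
next
  assume "inverse_path \<sigma> t < exit_time \<Omega> p"
  then obtain u where u: "0 < u" "ereal u < exit_time \<Omega> p" "t < \<sigma> u"
    using ereal_dense2 by (metis inverse_path_less_iff)
  have "ereal (\<sigma> u) \<le> exit_time (Some ` \<Omega>) ?X"
  proof (rule le_exit_timeI)
    fix s assume "?X s \<notin> Some ` \<Omega>"
    then have "exit_time \<Omega> p \<le> inverse_path \<sigma> s"
      using killed_path_alive_iff[of p, OF assms(1) inverse_path_nonneg] by (auto simp: not_less)
    with u(2) have "ereal u < inverse_path \<sigma> s" by (rule less_le_trans)
    then have "\<not> s < \<sigma> u" using inverse_path_le[OF \<open>0 < u\<close>, of s \<sigma>] by auto
    then show "ereal (\<sigma> u) \<le> ereal s" by simp
  qed
  moreover have "ereal t < ereal (\<sigma> u)" using u(3) by simp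
  ultimately show "ereal t < exit_time (Some ` \<Omega>) ?X" by (rule less_le_trans[rotated])
qed

section \<open>Independence of the motion and the clock\<close>

abbreviation path_algebra :: "'w measure \<Rightarrow> (real \<Rightarrow> 'w \<Rightarrow> 'a :: euclidean_space) \<Rightarrow> 'w measure"
  where "path_algebra M X \<equiv>
    vimage_algebra (space M) (\<lambda>\<omega>. \<lambda>t\<in>{0..}. X t \<omega>) (\<Pi>\<^sub>M t\<in>{0..}. borel)"

lemma measurable_path_algebra:
  assumes "0 \<le> t"
  shows "X t \<in> borel_measurable (path_algebra M X)"
proof -
  have "(\<lambda>\<omega>. \<lambda>t\<in>{0..}. X t \<omega>) \<in> measurable (path_algebra M X) (\<Pi>\<^sub>M t\<in>{0..}. borel)"
    by (rule measurable_vimage_algebra1) (auto simp: space_PiM)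
  from measurable_compose[OF this measurable_component_singleton[of t "{0..}"]] assms
  show ?thesis by simp
qed

lemma (in prob_space) indep_var_if_indep_set:
  assumes indep: "indep_set (sets F) (sets G)" and space: "space F = space M" "space G = space M"
    and X: "X \<in> measurable F A" and Y: "Y \<in> measurable G B"
  shows "indep_var A X B Y"
proof -
  have events: "sets F \<subseteq> events" "sets G \<subseteq> events"
    using indep by (auto simp: indep_set_def indep_sets_def UNIV_bool)
  have generated: "sigma_sets (space M) {Z -` D \<inter> space M |D. D \<in> sets C} \<subseteq> sets H"
    if "Z \<in> measurable H C" "space H = space M" for Z H C
    unfolding that(2)[symmetric]
    by (rule sets.sigma_sets_subset) (use measurable_sets[OF that(1)] in auto)
  have "random_variable A X" "random_variable B Y"
    using X Y space events by (auto simp: measurable_def)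
  moreover have "indep_set (sigma_sets (space M) {X -` D \<inter> space M |D. D \<in> sets A})
      (sigma_sets (space M) {Y -` D \<inter> space M |D. D \<in> sets B})"
    using generated[OF X space(1)] generated[OF Y space(2)] events
    by (intro indep_setI) (auto intro!: indep_setD[OF indep])
  ultimately show ?thesis by (simp add: indep_var_eq)
qed

text \<open>
  Fubini's theorem for the joint law, which by independence is a product measure.
\<close>

lemma (in prob_space) prob_less_indep_var:
  fixes X Y :: "'a \<Rightarrow> ereal"
  assumes "indep_var borel Y borel X"
  shows "emeasure M {\<omega> \<in> space M. X \<omega> < Y \<omega>}
    = (\<integral>\<^sup>+\<omega>. emeasure M {\<omega>' \<in> space M. X \<omega> < Y \<omega>'} \<partial>M)"
proof -
  have [measurable]: "random_variable borel X" "random_variable borel Y"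
    and prod: "distr M borel Y \<Otimes>\<^sub>M distr M borel X = distr M (borel \<Otimes>\<^sub>M borel) (\<lambda>\<omega>. (Y \<omega>, X \<omega>))"
    using assms unfolding indep_var_distribution_eq by auto
  interpret X: prob_space "distr M borel X" by (rule prob_space_distr) measurable
  interpret Y: prob_space "distr M borel Y" by (rule prob_space_distr) measurable
  interpret pair_sigma_finite "distr M borel Y" "distr M borel X" ..
  let ?A = "{z :: ereal \<times> ereal. snd z < fst z}"
  have A [measurable]: "?A \<in> sets (borel \<Otimes>\<^sub>M borel)"
  proof -
    have "{z \<in> space (borel \<Otimes>\<^sub>M borel). snd z < (fst z :: ereal)} \<in> sets (borel \<Otimes>\<^sub>M borel)"
      by measurable
    then show ?thesis by (simp add: space_pair_measure)
  qed
  have "emeasure M {\<omega> \<in> space M. X \<omega> < Y \<omega>} = emeasure (distr M (borel \<Otimes>\<^sub>M borel) (\<lambda>\<omega>. (Y \<omega>, X \<omega>))) ?A"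
    by (subst emeasure_distr) (auto intro!: arg_cong[where f = "emeasure M"])
  also have "\<dots> = emeasure (distr M borel Y \<Otimes>\<^sub>M distr M borel X) ?A"
    by (simp add: prod)
  also have "\<dots> = (\<integral>\<^sup>+x. emeasure (distr M borel Y) ((\<lambda>y. (y, x)) -` ?A) \<partial>distr M borel X)"
    by (intro emeasure_pair_measure_alt2) simp
  also have "\<dots> = (\<integral>\<^sup>+x. emeasure (distr M borel Y) {y. x < y} \<partial>distr M borel X)"
    by (simp add: vimage_def)
  also have "\<dots> = (\<integral>\<^sup>+x. emeasure M {\<omega>' \<in> space M. x < Y \<omega>'} \<partial>distr M borel X)"
    by (intro nn_integral_cong, subst emeasure_distr) (auto intro!: arg_cong[where f = "emeasure M"])
  also have "\<dots> = (\<integral>\<^sup>+\<omega>. emeasure M {\<omega>' \<in> space M. X \<omega> < Y \<omega>'} \<partial>M)"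
    by (subst nn_integral_distr) auto
  finally show ?thesis .
qed

section \<open>From small times to all times\<close>

text \<open>
  Away from \<open>0\<close> both the bounded function and each power \<open>u powr a n\<close> with \<open>a n \<le> r\<close> are dominated by a
  multiple of \<open>u powr r\<close>, so the remainder estimate extends from a neighbourhood of \<open>0\<close> to all
  \<open>u > 0\<close>.
\<close>

lemma uniform_bound_if_bounded_and_bigo_at_right_0:
  fixes f :: "real \<Rightarrow> real" and a :: "nat \<Rightarrow> real"
  assumes bound: "\<And>u. 0 < u \<Longrightarrow> \<bar>f u\<bar> \<le> B"
    and expansion: "(\<lambda>u. f u - (\<Sum>n\<in>I. c n * u powr a n)) \<in> O[at_right 0](\<lambda>u. u powr r)"
    and exponents: "0 \<le> r" "\<And>n. n \<in> I \<Longrightarrow> a n \<le> r"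
  obtains C where "\<And>u. 0 < u \<Longrightarrow> \<bar>f u - (\<Sum>n\<in>I. c n * u powr a n)\<bar> \<le> C * u powr r"
proof -
  obtain C where "0 < C"
    and "eventually (\<lambda>u. norm (f u - (\<Sum>n\<in>I. c n * u powr a n)) \<le> C * norm (u powr r)) (at_right 0)"
    using expansion by (elim landau_o.bigE)
  then obtain \<delta> where \<delta>: "0 < \<delta>"
    and small: "\<And>u. 0 < u \<Longrightarrow> u < \<delta> \<Longrightarrow> \<bar>f u - (\<Sum>n\<in>I. c n * u powr a n)\<bar> \<le> C * u powr r"
    unfolding eventually_at_right_field by auto
  define K where "K = B + (\<Sum>n\<in>I. \<bar>c n\<bar> * \<delta> powr a n)"
  have "0 \<le> B" using bound[of 1] by simp
  then have "0 \<le> K" unfolding K_def by (intro add_nonneg_nonneg sum_nonneg) auto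
  have large: "\<bar>f u - (\<Sum>n\<in>I. c n * u powr a n)\<bar> \<le> K / \<delta> powr r * u powr r" if "\<delta> \<le> u" for u
  proof -
    have one: "1 \<le> u / \<delta>" using that \<delta> by simp
    have "\<bar>c n * u powr a n\<bar> \<le> \<bar>c n\<bar> * \<delta> powr a n * (u / \<delta>) powr r" if "n \<in> I" for n
    proof -
      have "u powr a n = \<delta> powr a n * (u / \<delta>) powr a n"
        using \<open>\<delta> \<le> u\<close> \<delta> by (simp add: powr_divide)
      also have "\<dots> \<le> \<delta> powr a n * (u / \<delta>) powr r"
        using one exponents(2)[OF that] by (intro mult_left_mono powr_mono) auto
      finally show ?thesis by (simp add: abs_mult mult.assoc mult_left_mono)
    qed
    then have "\<bar>\<Sum>n\<in>I. c n * u powr a n\<bar> \<le> (\<Sum>n\<in>I. \<bar>c n\<bar> * \<delta> powr a n * (u / \<delta>) powr r)"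
      by (rule order_trans[OF sum_abs sum_mono])
    moreover have "\<bar>f u\<bar> \<le> B * (u / \<delta>) powr r"
    proof -
      have "\<bar>f u\<bar> \<le> B * 1" using bound[of u] that \<delta> by simp
      also have "\<dots> \<le> B * (u / \<delta>) powr r"
        using \<open>0 \<le> B\<close> one exponents(1) by (intro mult_left_mono ge_one_powr_ge_zero) auto
      finally show ?thesis .
    qed
    ultimately have "\<bar>f u - (\<Sum>n\<in>I. c n * u powr a n)\<bar> \<le> K * (u / \<delta>) powr r"
      unfolding K_def distrib_right sum_distrib_right by linarith
    also have "\<dots> = K / \<delta> powr r * u powr r"
      using that \<delta> by (simp add: powr_divide)
    finally show ?thesis .
  qed
  show ?thesis
  proof (rule that)
    fix u :: real assume "0 < u"
    have "C * u powr r \<le> (C + K / \<delta> powr r) * u powr r"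
      and "K / \<delta> powr r * u powr r \<le> (C + K / \<delta> powr r) * u powr r"
      using \<open>0 < C\<close> \<open>0 \<le> K\<close> by (intro mult_right_mono; simp)+
    then show "\<bar>f u - (\<Sum>n\<in>I. c n * u powr a n)\<bar> \<le> (C + K / \<delta> powr r) * u powr r"
      using small[OF \<open>0 < u\<close>] large[of u] by (cases "u < \<delta>") auto
  qed
qed

section \<open>Heat contents\<close>

lemma heat_content_alt:
  "\<Omega> \<in> sets borel \<Longrightarrow> heat_content M W \<Omega> t =
    (LINT x|restrict_space lborel \<Omega>. measure M {\<omega> \<in> space M. ereal t < exit_time \<Omega> (\<lambda>s. x + W s \<omega>)})"
  by (simp add: heat_content_def set_lebesgue_integral_def integral_restrict_space)

lemma finite_measure_restrict_lborel:
  assumes "open \<Omega>" and "bounded \<Omega>"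
  shows "finite_measure (restrict_space lborel \<Omega>)"
    and "measure (restrict_space lborel \<Omega>) (space (restrict_space lborel \<Omega>)) = measure lborel \<Omega>"
proof -
  have "emeasure (restrict_space lborel \<Omega>) (space (restrict_space lborel \<Omega>)) = emeasure lborel \<Omega>"
    using assms(1) by (subst emeasure_restrict_space) (auto simp: space_restrict_space)
  then show "finite_measure (restrict_space lborel \<Omega>)"
    and "measure (restrict_space lborel \<Omega>) (space (restrict_space lborel \<Omega>)) = measure lborel \<Omega>"
    using emeasure_bounded_finite[OF assms(2)] by (auto simp: measure_def intro!: finite_measureI)
qed

lemma heat_content_bounds:
  assumes "prob_space M" and "open \<Omega>" and "bounded \<Omega>"
  shows "0 \<le> heat_content M W \<Omega> t" and "heat_content M W \<Omega> t \<le> measure lborel \<Omega>"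
proof -
  interpret M: prob_space M by fact
  interpret L: finite_measure "restrict_space lborel \<Omega>"
    using assms by (intro finite_measure_restrict_lborel)
  let ?h = "\<lambda>x. measure M {\<omega> \<in> space M. ereal t < exit_time \<Omega> (\<lambda>s. x + W s \<omega>)}"
  have alt: "heat_content M W \<Omega> t = (LINT x|restrict_space lborel \<Omega>. ?h x)"
    using assms by (intro heat_content_alt) auto
  show "0 \<le> heat_content M W \<Omega> t" unfolding alt by (intro Bochner_Integration.integral_nonneg) auto
  have "(LINT x|restrict_space lborel \<Omega>. ?h x) \<le> (LINT x|restrict_space lborel \<Omega>. 1)"
    by (intro integral_mono') auto
  then show "heat_content M W \<Omega> t \<le> measure lborel \<Omega>"
    unfolding alt using finite_measure_restrict_lborel(2)[OF assms(2,3)] by simp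
qed

text \<open>
  For a fixed starting point \<open>x\<close> the survival probability is \<open>P(E\<^sub>t < \<tau>\<^sub>x)\<close>. As \<open>E\<^sub>t\<close> and \<open>\<tau>\<^sub>x\<close> are
  measurable with respect to the independent \<open>\<sigma>\<close>-algebras of the two processes, it is the expectation of
  \<open>h x (E\<^sub>t)\<close>, where \<open>h x e = P(\<tau>\<^sub>x > e)\<close>. Integrating over \<open>x\<close> first turns \<open>h\<close> into the Brownian heat
  content. The real-valued \<open>e\<close> agrees almost surely with \<open>E t\<close> and stands in for it, because heat contents
  are only defined at finite times.
\<close>

lemma time_changed_heat_content_eq_expectation:
  fixes W :: "real \<Rightarrow> 'w \<Rightarrow> 'a :: euclidean_space"
  assumes "0 < \<beta>" and "brownian_motion M W" and "stable_subordinator M \<beta> S"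
    and indep: "independent_processes M W S"
    and "open \<Omega>" and "bounded \<Omega>" and "0 < t"
  shows "has_bochner_integral M
    (\<lambda>\<omega>. heat_content M W \<Omega> (real_of_ereal (inverse_path (\<lambda>u. S u \<omega>) t)))
    (time_changed_heat_content M W S \<Omega> t)"
proof -
  interpret W: brownian_motion M W by fact
  interpret S: stable_subordinator M \<beta> S by fact
  define L where "L = restrict_space lborel \<Omega>"
  interpret L: finite_measure L
    unfolding L_def using assms by (intro finite_measure_restrict_lborel)
  interpret LM: pair_sigma_finite L M ..
  interpret LM: finite_measure "L \<Otimes>\<^sub>M M"
    by (rule finite_measure_pair_measure) unfold_locales
  have space_L: "space L = \<Omega>" unfolding L_def by (simp add: space_restrict_space)
  have "\<Omega> \<noteq> UNIV" using \<open>bounded \<Omega>\<close> not_bounded_UNIV by auto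
  define \<tau> where "\<tau> x \<omega> = exit_time \<Omega> (\<lambda>s. x + W s \<omega>)" for x \<omega>
  define e where "e \<omega> = real_of_ereal (S.E t \<omega>)" for \<omega>
  have e [measurable]: "e \<in> borel_measurable M" unfolding e_def by measurable
  define h where "h x e = measure M {\<omega> \<in> space M. e < \<tau> x \<omega>}" for x e
  have [measurable]: "(\<lambda>z. \<tau> (fst z) (snd z)) \<in> borel_measurable (L \<Otimes>\<^sub>M M)"
    unfolding \<tau>_def
  proof (rule borel_measurable_exit_time[OF \<open>open \<Omega>\<close> \<open>\<Omega> \<noteq> UNIV\<close>])
    fix s :: real assume "0 \<le> s"
    then have [measurable]: "W s \<in> borel_measurable M" by (rule W.measurable_process)
    have [measurable]: "(\<lambda>x. x) \<in> borel_measurable L"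
      unfolding L_def by (rule measurable_restrict_space1) simp
    have [measurable]: "fst \<in> borel_measurable (L \<Otimes>\<^sub>M M)"
      using measurable_compose[OF measurable_fst \<open>(\<lambda>x. x) \<in> borel_measurable L\<close>] by simp
    show "(\<lambda>z. fst z + W s (snd z)) \<in> borel_measurable (L \<Otimes>\<^sub>M M)" by measurable
  qed (auto simp: space_pair_measure space_L W.starts_at_0 intro!: continuous_intros W.continuous_paths)
  have \<tau>_meas: "(\<lambda>z. \<tau> (g z) (k z)) \<in> borel_measurable N"
    if "g \<in> measurable N L" "k \<in> measurable N M" for g k and N :: "'z measure"
    using measurable_compose[OF measurable_Pair[OF that] \<open>(\<lambda>z. \<tau> (fst z) (snd z)) \<in> _\<close>] by simp
  have survival: "time_changed_heat_content M W S \<Omega> t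
      = (LINT x|L. measure M {\<omega> \<in> space M. S.E t \<omega> < \<tau> x \<omega>})"
  proof -
    have "exit_time (Some ` \<Omega>) (\<lambda>s. killed_path \<Omega> (\<lambda>r. x + W r \<omega>) (S.E s \<omega>)) > ereal t \<longleftrightarrow> S.E t \<omega> < \<tau> x \<omega>"
      if "x \<in> \<Omega>" "\<omega> \<in> space M" for x \<omega>
      unfolding \<tau>_def using that assms by (intro time_changed_exit_time_iff) (auto simp: W.starts_at_0)
    then have "measure M {\<omega> \<in> space M. exit_time (Some ` \<Omega>) (\<lambda>s. killed_path \<Omega> (\<lambda>r. x + W r \<omega>) (S.E s \<omega>)) > ereal t}
        = measure M {\<omega> \<in> space M. S.E t \<omega> < \<tau> x \<omega>}" if "x \<in> \<Omega>" for x
      using that by (intro arg_cong[where f = "measure M"]) auto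
    then show ?thesis
      using \<open>open \<Omega>\<close> unfolding time_changed_heat_content_def L_def set_lebesgue_integral_def
      by (subst integral_restrict_space) (auto intro!: Bochner_Integration.integral_cong simp: indicator_def)
  qed
  have independence: "measure M {\<omega> \<in> space M. S.E t \<omega> < \<tau> x \<omega>} = (LINT \<omega>|M. h x (ereal (e \<omega>)))"
    if "x \<in> \<Omega>" for x
  proof -
    have \<tau>_W: "\<tau> x \<in> borel_measurable (path_algebra M W)"
      unfolding \<tau>_def using that
      by (intro borel_measurable_exit_time[OF \<open>open \<Omega>\<close> \<open>\<Omega> \<noteq> UNIV\<close>])
        (auto simp: W.starts_at_0 intro!: continuous_intros W.continuous_paths borel_measurable_add measurable_path_algebra)
    have "(\<lambda>z. inverse_path (\<lambda>u. S u (snd z)) (fst z)) \<in> borel_measurable (borel \<Otimes>\<^sub>M path_algebra M S)"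
      by (intro borel_measurable_inverse_path) (auto intro!: measurable_path_algebra S.strictly_increasing_paths)
    from measurable_compose[OF measurable_Pair1'[of t borel] this]
    have "S.E t \<in> borel_measurable (path_algebra M S)" by simp
    then have e_S: "(\<lambda>\<omega>. ereal (e \<omega>)) \<in> borel_measurable (path_algebra M S)"
      unfolding e_def by measurable
    have indep_var: "W.indep_var borel (\<tau> x) borel (\<lambda>\<omega>. ereal (e \<omega>))"
      using indep unfolding independent_processes_def
      by (rule W.indep_var_if_indep_set) (use e_S \<tau>_W in auto)
    then have [measurable]: "\<tau> x \<in> borel_measurable M" by (rule W.indep_var_rv1)
    have "measure M {\<omega> \<in> space M. S.E t \<omega> < \<tau> x \<omega>} = measure M {\<omega> \<in> space M. ereal (e \<omega>) < \<tau> x \<omega>}"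
    proof (rule W.finite_measure_eq_AE)
      show "AE \<omega> in M. \<omega> \<in> {\<omega> \<in> space M. S.E t \<omega> < \<tau> x \<omega>} \<longleftrightarrow> \<omega> \<in> {\<omega> \<in> space M. ereal (e \<omega>) < \<tau> x \<omega>}"
        using S.inverse_subordinator_finite[OF \<open>0 < \<beta>\<close> \<open>0 < t\<close>] unfolding e_def
        by eventually_elim (metis (mono_tags, lifting) mem_Collect_eq)
    qed measurable
    moreover have "emeasure M {\<omega> \<in> space M. ereal (e \<omega>) < \<tau> x \<omega>} = (\<integral>\<^sup>+\<omega>. ennreal (h x (ereal (e \<omega>))) \<partial>M)"
      unfolding h_def W.emeasure_eq_measure[symmetric] by (rule W.prob_less_indep_var[OF indep_var])
    moreover have "(\<lambda>\<omega>. h x (ereal (e \<omega>))) \<in> borel_measurable M"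
      unfolding h_def measure_def by measurable
    ultimately show ?thesis
      by (subst integral_eq_nn_integral) (auto simp: measure_def h_def)
  qed
  have h_meas: "(\<lambda>z. h (fst z) (ereal (e (snd z)))) \<in> borel_measurable (L \<Otimes>\<^sub>M M)"
  proof -
    have [measurable]: "(\<lambda>y. \<tau> (fst (fst y)) (snd y)) \<in> borel_measurable ((L \<Otimes>\<^sub>M M) \<Otimes>\<^sub>M M)"
      by (rule \<tau>_meas) measurable
    let ?A = "{y \<in> space ((L \<Otimes>\<^sub>M M) \<Otimes>\<^sub>M M). ereal (e (snd (fst y))) < \<tau> (fst (fst y)) (snd y)}"
    have "(\<lambda>z. emeasure M (Pair z -` ?A)) \<in> borel_measurable (L \<Otimes>\<^sub>M M)"
      by (rule W.measurable_emeasure_Pair) measurable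
    moreover have "h (fst z) (ereal (e (snd z))) = enn2real (emeasure M (Pair z -` ?A))"
      if "z \<in> space (L \<Otimes>\<^sub>M M)" for z
      using that unfolding h_def measure_def
      by (intro arg_cong[where f = "\<lambda>A. enn2real (emeasure M A)"]) (auto simp: space_pair_measure)
    ultimately show ?thesis
      by (subst measurable_cong[where g = "\<lambda>z. enn2real (emeasure M (Pair z -` ?A))"])
        (auto intro: borel_measurable_enn2real)
  qed
  have integrable: "integrable (L \<Otimes>\<^sub>M M) (\<lambda>(x, \<omega>). h x (ereal (e \<omega>)))"
    using h_meas by (intro LM.integrable_const_bound[where B = 1]) (auto simp: h_def case_prod_beta')
  have content: "heat_content M W \<Omega> (e \<omega>) = (LINT x|L. h x (ereal (e \<omega>)))" for \<omega>
    using \<open>open \<Omega>\<close> by (subst heat_content_alt) (auto simp: L_def h_def \<tau>_def)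
  have "time_changed_heat_content M W S \<Omega> t = (LINT x|L. LINT \<omega>|M. h x (ereal (e \<omega>)))"
    unfolding survival by (intro Bochner_Integration.integral_cong) (auto simp: independence space_L)
  also have "\<dots> = (LINT \<omega>|M. LINT x|L. h x (ereal (e \<omega>)))"
    by (rule LM.Fubini_integral[OF integrable, symmetric])
  finally show ?thesis
    using LM.integrable_snd[OF integrable] unfolding e_def[symmetric] content
    by (simp add: has_bochner_integral_iff)
qed

section \<open>The expansion of the time-changed heat content\<close>

theorem theorem4p6:
  fixes M :: "'w measure"
    and W :: "real \<Rightarrow> 'w \<Rightarrow> 'a :: euclidean_space"
    and S :: "real \<Rightarrow> 'w \<Rightarrow> real"
    and \<beta> :: real
    and \<Omega> :: "'a set"
    and c :: "nat \<Rightarrow> real"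
    and N :: nat
  assumes "0 < \<beta>" and "\<beta> < 1"
    and "brownian_motion M W"
    and "stable_subordinator M \<beta> S"
    and "independent_processes M W S"
    and "open \<Omega>" and "bounded \<Omega>" and "connected \<Omega>"
    and "smooth_boundary \<Omega>"
    and "\<And>K :: nat.
      (\<lambda>t. measure lborel \<Omega> - heat_content M W \<Omega> t - (\<Sum>n=1..K. c n * t powr (real n / 2)))
        \<in> O[at_right 0](\<lambda>t. t powr (real (K + 1) / 2))"
  shows "(\<lambda>t. measure lborel \<Omega> - time_changed_heat_content M W S \<Omega> t
            - (\<Sum>n=1..N. c n * (Gamma (1 + real n / 2) / Gamma (1 + real n * \<beta> / 2))
                * t powr (\<beta> * real n / 2)))
        \<in> O[at_right 0](\<lambda>t. t powr (\<beta> * real (N + 1) / 2))"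
proof -
  interpret S: stable_subordinator M \<beta> S by fact
  have "0 \<le> measure lborel \<Omega> - heat_content M W \<Omega> u" "measure lborel \<Omega> - heat_content M W \<Omega> u \<le> measure lborel \<Omega>" for u
    using heat_content_bounds[OF S.prob_space_axioms \<open>open \<Omega>\<close> \<open>bounded \<Omega>\<close>, of W u] by auto
  then have "\<bar>measure lborel \<Omega> - heat_content M W \<Omega> u\<bar> \<le> measure lborel \<Omega>" for u
    by (simp add: abs_le_iff)
  then obtain C where C: "\<And>u. 0 < u \<Longrightarrow>
      \<bar>measure lborel \<Omega> - heat_content M W \<Omega> u - (\<Sum>n=1..N. c n * u powr (real n / 2))\<bar>
        \<le> C * u powr (real (N + 1) / 2)"
    by (rule uniform_bound_if_bounded_and_bigo_at_right_0[OF _ assms(10)[of N]]) auto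
  \<comment> \<open>The moment of order \<open>p\<close> of the inverse subordinator at time \<open>1\<close>.\<close>
  define m where "m p = Gamma (1 + p) / Gamma (1 + \<beta> * p)" for p
  have "\<bar>measure lborel \<Omega> - time_changed_heat_content M W S \<Omega> t
      - (\<Sum>n=1..N. c n * (m (real n / 2) * t powr (\<beta> * (real n / 2))))\<bar>
      \<le> C * (m (real (N + 1) / 2) * t powr (\<beta> * (real (N + 1) / 2)))" if "0 < t" for t
  proof -
    define e where "e \<omega> = real_of_ereal (S.E t \<omega>)" for \<omega>
    define f where "f u = measure lborel \<Omega> - heat_content M W \<Omega> u - (\<Sum>n=1..N. c n * u powr (real n / 2))" for u
    have moment: "has_bochner_integral M (\<lambda>\<omega>. e \<omega> powr p) (m p * t powr (\<beta> * p))" if "0 < p" for p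
      unfolding e_def m_def using assms(1) that \<open>0 < t\<close>
      by (rule S.has_bochner_integral_inverse_subordinator_powr)
    have "has_bochner_integral M (\<lambda>\<omega>. heat_content M W \<Omega> (e \<omega>)) (time_changed_heat_content M W S \<Omega> t)"
      unfolding e_def using assms(1,3-7) \<open>0 < t\<close> by (rule time_changed_heat_content_eq_expectation)
    moreover have "has_bochner_integral M (\<lambda>_. measure lborel \<Omega>) (measure lborel \<Omega>)"
      by (simp add: has_bochner_integral_iff S.prob_space)
    moreover have "has_bochner_integral M (\<lambda>\<omega>. \<Sum>n=1..N. c n * e \<omega> powr (real n / 2))
        (\<Sum>n=1..N. c n * (m (real n / 2) * t powr (\<beta> * (real n / 2))))"
      by (intro has_bochner_integral_sum has_bochner_integral_mult_right moment) auto
    ultimately have f: "has_bochner_integral M (\<lambda>\<omega>. f (e \<omega>)) (measure lborel \<Omega> - time_changed_heat_content M W S \<Omega> t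
        - (\<Sum>n=1..N. c n * (m (real n / 2) * t powr (\<beta> * (real n / 2)))))"
      unfolding f_def by (intro has_bochner_integral_diff)
    have bound: "has_bochner_integral M (\<lambda>\<omega>. C * e \<omega> powr (real (N + 1) / 2))
        (C * (m (real (N + 1) / 2) * t powr (\<beta> * (real (N + 1) / 2))))"
      by (intro has_bochner_integral_mult_right moment) auto
    have "\<bar>LINT \<omega>|M. f (e \<omega>)\<bar> \<le> (LINT \<omega>|M. \<bar>f (e \<omega>)\<bar>)"
      by (rule integral_abs_bound)
    also have "\<dots> \<le> (LINT \<omega>|M. C * e \<omega> powr (real (N + 1) / 2))"
    proof (rule integral_mono_AE)
      show "AE \<omega> in M. \<bar>f (e \<omega>)\<bar> \<le> C * e \<omega> powr (real (N + 1) / 2)"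
        using S.inverse_subordinator_finite[OF assms(1) \<open>0 < t\<close>]
      proof eventually_elim
        case (elim \<omega>)
        then show ?case using C[of "e \<omega>"] by (simp only: f_def e_def)
      qed
    qed (use f bound in \<open>auto simp: has_bochner_integral_iff\<close>)
    finally show ?thesis
      unfolding has_bochner_integral_integral_eq[OF f] has_bochner_integral_integral_eq[OF bound] .
  qed
  then have *: "\<bar>measure lborel \<Omega> - time_changed_heat_content M W S \<Omega> t
      - (\<Sum>n=1..N. c n * (m (real n / 2) * t powr (\<beta> * (real n / 2))))\<bar>
      \<le> C * m (real (N + 1) / 2) * \<bar>t powr (\<beta> * (real (N + 1) / 2))\<bar>" if "0 < t" for t
    using that by (simp add: mult.assoc)
  show ?thesis
  proof (rule bigoI)
    show "\<forall>\<^sub>F t in at_right 0. norm (measure lborel \<Omega> - time_changed_heat_content M W S \<Omega> t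
            - (\<Sum>n=1..N. c n * (Gamma (1 + real n / 2) / Gamma (1 + real n * \<beta> / 2))
                * t powr (\<beta> * real n / 2)))
        \<le> C * m (real (N + 1) / 2) * norm (t powr (\<beta> * real (N + 1) / 2))"
      using eventually_at_right_less[of 0]
    proof eventually_elim
      case (elim t)
      with *[of t] show ?case by (simp add: m_def mult_ac)
    qed
  qed
qed

end
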